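(* For a simple matroid $N$ of rank 4 on a finite set $S$, let $P(N)$ be the assertion: $$W_2(N)^2\;\geq\;\frac{3(W_1(N)-1)}{2(W_1(N)-2)}\,W_1(N)\,W_3(N),$$ with equality if and only if $\mathcal{F}_3(N)=\binom{S}{3}$. Then the following are equivalent: (a) (the points-lines-planes conjecture) $P(N)$ holds for every simple rank-4 matroid $N$ on every finite set; (b) $P(N)$ holds for every rank-4 matroid $N$ that is the free erection of some simple rank-3 matroid, i.e. for every $N$ of the form $N=\mathrm{Free}(M)$, where $M$ is a simple rank-3 matroid on a finite set with $\mathrm{Free}(M)\neq M$.
   Context: A matroid is simple if every subset of its ground set of size at most 2 is independent. For a matroid $M$, $\mathcal{F}_k(M)$ is the collection of its rank-$k$ flats and $W_k(M)=|\mathcal{F}_k(M)|$. $\binom{S}{3}$ denotes the collection of all 3-element subsets of $S$. Free erection. Let $\mathcal{T},\mathcal{T}'$ be collections of subsets of a finite set $S$. Define $\mathrm{Expand}(\mathcal{T})=\{A\cup\{a\}: A\in\mathcal{T},\ a\in S\setminus A\}$. Define $\mathrm{Refine}(\mathcal{T},\mathcal{T}')$ to be the collection obtained from $\mathcal{T}$ by repeating the following as long as possible: if there are $A\neq B$ in the current collection such that $A\cap B\not\subseteq C$ for every $C\in\mathcal{T}'$, replace $A$ and $B$ by the single set $A\cup B$. (For the use below the outcome is known not to depend on the order of replacements.) Let $M$ be a simple rank-3 matroid on $S$, with hyperplanes (lines) $\mathcal{F}_2(M)$, and let $\mathcal{F}'_3=\mathrm{Refine}(\mathrm{Expand}(\mathcal{F}_2(M)),\mathcal{F}_2(M))$.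 The free erection $\mathrm{Free}(M)$ is the matroid on $S$ whose flats are the members of $\mathcal{F}(M)\cup\mathcal{F}'_3$, where $\mathcal{F}(M)$ is the collection of all flats of $M$ (including $S$). If $\mathcal{F}'_3=\{S\}$ then $\mathrm{Free}(M)=M$ (the trivial erection); otherwise $\mathrm{Free}(M)$ is a simple rank-4 matroid with $\mathcal{F}_i(\mathrm{Free}(M))=\mathcal{F}_i(M)$ for $i\leq 2$ and $\mathcal{F}_3(\mathrm{Free}(M))=\mathcal{F}'_3$. *)

theory Defs
  imports Complex_Main
begin

section \<open>Matroids\<close>

record 'a set_system =
  ground :: "'a set"
  indeps :: "'a set set"

definition matroid :: "'a set_system \<Rightarrow> bool" where
  "matroid M \<longleftrightarrow>
     finite (ground M) \<and>
     indeps M \<subseteq> Pow (ground M) \<and>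
     {} \<in> indeps M \<and>
     (\<forall>J\<in>indeps M. \<forall>I\<subseteq>J. I \<in> indeps M) \<and>
     (\<forall>I\<in>indeps M. \<forall>J\<in>indeps M. card I < card J \<longrightarrow> (\<exists>x\<in>J - I. insert x I \<in> indeps M))"

definition rank_of :: "'a set_system \<Rightarrow> 'a set \<Rightarrow> nat" where
  "rank_of M X = Max (card ` {I \<in> indeps M. I \<subseteq> X})"

definition matroid_rank :: "'a set_system \<Rightarrow> nat" where
  "matroid_rank M = rank_of M (ground M)"

definition simple_matroid :: "'a set_system \<Rightarrow> bool" where
  "simple_matroid M \<longleftrightarrow> matroid M \<and> (\<forall>X\<subseteq>ground M. card X \<le> 2 \<longrightarrow> X \<in> indeps M)"

definition flats :: "'a set_system \<Rightarrow> 'a set set" where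
  "flats M = {F. F \<subseteq> ground M \<and> (\<forall>x\<in>ground M - F. rank_of M F < rank_of M (insert x F))}"

definition flats_of_rank :: "nat \<Rightarrow> 'a set_system \<Rightarrow> 'a set set" where
  "flats_of_rank k M = {F \<in> flats M. rank_of M F = k}"

definition whitney :: "nat \<Rightarrow> 'a set_system \<Rightarrow> nat" where
  "whitney k M = card (flats_of_rank k M)"


section \<open>Free erections\<close>

definition expand :: "'a set \<Rightarrow> 'a set set \<Rightarrow> 'a set set" where
  "expand S T = {insert a A | A a. A \<in> T \<and> a \<in> S - A}"

definition refine_step :: "'a set set \<Rightarrow> 'a set set \<Rightarrow> 'a set set \<Rightarrow> bool" where
  "refine_step T' U V \<longleftrightarrow>
     (\<exists>A\<in>U. \<exists>B\<in>U. A \<noteq> B \<and> (\<forall>C\<in>T'. \<not> A \<inter> B \<subseteq> C) \<and> V = insert (A \<union> B) (U - {A, B}))"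

definition refine_outcome :: "'a set set \<Rightarrow> 'a set set \<Rightarrow> 'a set set \<Rightarrow> bool" where
  "refine_outcome T T' R \<longleftrightarrow> (refine_step T')\<^sup>*\<^sup>* T R \<and> \<not> (\<exists>V. refine_step T' R V)"

text \<open>
  The choice is immaterial wherever the operation is used below: an outcome exists for finite
  collections, and it is unique if no member of \<open>T\<close> lies inside a member of \<open>T'\<close>.
  The latter holds for the expansion of the flats of rank \<open>k\<close>, taken against these same flats.
\<close>

definition refine :: "'a set set \<Rightarrow> 'a set set \<Rightarrow> 'a set set" where
  "refine T T' = (SOME R. refine_outcome T T' R)"

lemma refine_outcome_exists:
  assumes "finite T"
  shows "\<exists>R. refine_outcome T T' R"
  using assms
proof (induction "card T" arbitrary: T rule: less_induct)
  case less
  show ?case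
  proof (cases "\<exists>V. refine_step T' T V")
    case False
    then show ?thesis unfolding refine_outcome_def by blast
  next
    case True
    then obtain V where V: "refine_step T' T V" by blast
    then obtain A B where AB: "A \<in> T" "B \<in> T" "A \<noteq> B" "V = insert (A \<union> B) (T - {A, B})"
      unfolding refine_step_def by blast
    have "card V \<le> Suc (card (T - {A, B}))"
      using AB(4) less.prems by (simp add: card_insert_le_m1 card_insert_if)
    moreover have "Suc (Suc (card (T - {A, B}))) = card T"
    proof -
      have "card {A, B} \<le> card T" using AB less.prems by (intro card_mono) auto
      then show ?thesis using AB less.prems by (simp add: card_Diff_subset)
    qed
    ultimately have "card V < card T" by simp
    moreover have "finite V" using AB less.prems by simp
    ultimately obtain R where "refine_outcome V T' R" using less.hyps by blast
    then show ?thesis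
      using V unfolding refine_outcome_def by (meson converse_rtranclp_into_rtranclp)
  qed
qed

lemma refine_outcome_unique:
  assumes proper: "\<And>A C. A \<in> T \<Longrightarrow> C \<in> T' \<Longrightarrow> \<not> A \<subseteq> C"
    and R1: "refine_outcome T T' R1" and R2: "refine_outcome T T' R2"
  shows "R1 = R2"
proof -
  have up: "\<forall>A\<in>T. \<exists>X\<in>U. A \<subseteq> X" if "(refine_step T')\<^sup>*\<^sup>* T U" for U
    using that
  proof induction
    case (step U V)
    from step.hyps(2) obtain A B where V: "V = insert (A \<union> B) (U - {A, B})"
      unfolding refine_step_def by blast
    have cover: "\<exists>Y\<in>V. X \<subseteq> Y" if "X \<in> U" for X
      using that V by (cases "X = A \<or> X = B") auto
    show ?case
    proof
      fix A assume "A \<in> T"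
      then obtain X where "X \<in> U" "A \<subseteq> X" using step.IH by blast
      then show "\<exists>X\<in>V. A \<subseteq> X" using cover by (meson order_trans)
    qed
  qed blast
  have down: "\<forall>X\<in>U. \<exists>A\<in>T. A \<subseteq> X" if "(refine_step T')\<^sup>*\<^sup>* T U" for U
    using that
  proof induction
    case (step U V)
    from step.hyps(2) obtain A B where AB: "A \<in> U" "V = insert (A \<union> B) (U - {A, B})"
      unfolding refine_step_def by blast
    show ?case
    proof
      fix X assume "X \<in> V"
      then obtain Y where "Y \<in> U" "Y \<subseteq> X" using AB by blast
      then show "\<exists>D\<in>T. D \<subseteq> X" using step.IH by (meson order_trans)
    qed
  qed blast
  have same: "X = Y" if "refine_outcome T T' R" "X \<in> R" "Y \<in> R" "D \<subseteq> X" "D \<subseteq> Y"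
    "\<And>C. C \<in> T' \<Longrightarrow> \<not> D \<subseteq> C" for R X Y D
  proof (rule ccontr)
    assume "X \<noteq> Y"
    moreover have "\<forall>C\<in>T'. \<not> X \<inter> Y \<subseteq> C" using that(4-6) by blast
    ultimately have "refine_step T' R (insert (X \<union> Y) (R - {X, Y}))"
      using that(2,3) unfolding refine_step_def by blast
    then show False using that(1) unfolding refine_outcome_def by blast
  qed
  have absorb: "\<forall>A\<in>U. \<exists>X\<in>R. A \<subseteq> X"
    if "(refine_step T')\<^sup>*\<^sup>* T U" and R: "refine_outcome T T' R" for U R
    using that(1)
  proof induction
    case base
    then show ?case using up R unfolding refine_outcome_def by blast
  next
    case (step U V)
    from step.hyps(2) obtain A B where AB: "A \<in> U" "B \<in> U" "\<forall>C\<in>T'. \<not> A \<inter> B \<subseteq> C"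
      "V = insert (A \<union> B) (U - {A, B})"
      unfolding refine_step_def by blast
    from step.IH AB(1) obtain X where X: "X \<in> R" "A \<subseteq> X" by blast
    from step.IH AB(2) obtain Y where Y: "Y \<in> R" "B \<subseteq> Y" by blast
    have "X = Y"
    proof (rule same[OF R X(1) Y(1), of "A \<inter> B"])
      show "A \<inter> B \<subseteq> X" "A \<inter> B \<subseteq> Y" using X(2) Y(2) by blast+
      show "\<not> A \<inter> B \<subseteq> C" if "C \<in> T'" for C using AB(3) that by simp
    qed
    then have "A \<union> B \<subseteq> X" using X(2) Y(2) by blast
    show ?case
    proof
      fix D assume "D \<in> V"
      then consider "D \<in> U" | "D = A \<union> B" using AB(4) by blast
      then show "\<exists>X\<in>R. D \<subseteq> X"
        by cases (use step.IH \<open>A \<union> B \<subseteq> X\<close> X(1) in blast)+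
    qed
  qed
  have incl: "R \<subseteq> R'" if R: "refine_outcome T T' R" and R': "refine_outcome T T' R'" for R R'
  proof
    fix X assume X: "X \<in> R"
    obtain Y where Y: "Y \<in> R'" "X \<subseteq> Y"
      using absorb[OF _ R'] R X unfolding refine_outcome_def by blast
    obtain Z where Z: "Z \<in> R" "Y \<subseteq> Z"
      using absorb[OF _ R] R' Y unfolding refine_outcome_def by blast
    obtain A where A: "A \<in> T" "A \<subseteq> X"
      using down R X unfolding refine_outcome_def by blast
    have "A \<subseteq> Z" using A(2) Y(2) Z(2) by simp
    then have "X = Z" by (rule same[OF R X Z(1) A(2)]) (rule proper[OF A(1)])
    then have "X = Y" using Y(2) Z(2) by simp
    then show "X \<in> R'" using Y(1) by simp
  qed
  show ?thesis using incl R1 R2 by blast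
qed

text \<open>
  The candidate family of planes of the free erection of a rank-3 matroid, whose hyperplanes
  are its flats of rank 2.
\<close>

definition erection_planes :: "'a set_system \<Rightarrow> 'a set set" where
  "erection_planes M = refine (expand (ground M) (flats_of_rank 2 M)) (flats_of_rank 2 M)"

definition free_erection :: "'a set_system \<Rightarrow> 'a set_system" where
  "free_erection M =
     (THE N. matroid N \<and> ground N = ground M \<and> flats N = flats M \<union> erection_planes M)"


section \<open>The points-lines-planes property\<close>

definition points_lines_planes :: "'a set_system \<Rightarrow> bool" where
  "points_lines_planes N \<longleftrightarrow>
     (let W = (\<lambda>k. real (whitney k N));
          bound = 3 * (W 1 - 1) / (2 * (W 1 - 2)) * W 1 * W 3
      in (W 2)\<^sup>2 \<ge> bound \<and>
         ((W 2)\<^sup>2 = bound \<longleftrightarrow> flats_of_rank 3 N = {X. X \<subseteq> ground N \<and> card X = 3}))"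

end

theory Submission
  imports Defs
begin

text \<open>
  Only the passage from free erections to all rank-4 matroids carries content about the inequality.
  Given a simple rank-4 matroid \<open>N\<close>, let \<open>M\<close> be its truncation to rank 3, which has the same points
  and lines, and let \<open>E\<close> be the free erection of \<open>M\<close>. A refinement step merges two sets
  only if their intersection spans a plane, so the sets produced while computing \<open>E\<close> never leave the
  planes of \<open>N\<close> (\<open>erection_plane_truncation_rank\<close>). Hence everything independent in \<open>N\<close> is
  independent in \<open>E\<close>; in particular \<open>E\<close> has rank 4 and differs from \<open>M\<close>.

  Sending a plane of \<open>E\<close> to the plane of \<open>N\<close> containing it is a surjection, so
  \<open>W\<^sub>1\<close> and \<open>W\<^sub>2\<close> agree while \<open>W\<^sub>3(N) \<le> W\<^sub>3(E)\<close>, and the inequality for \<open>E\<close> implies that for \<open>N\<close>.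
  Equality for \<open>N\<close> amounts to equality for \<open>E\<close> together with injectivity of this map. If the planes
  of \<open>E\<close> are the triples, then injectivity says that no plane of \<open>N\<close> contains
  two triples, which makes the planes of \<open>N\<close> the triples as well
  (\<open>points_lines_planes_specialize\<close>).

  For this argument, and for the converse, the free erection has to be a matroid. The planes
  produced by refinement cover each line together with any further point, and each noncollinear
  triple lies in exactly one of them. For any such family, calling a 4-set independent when it lies in
  no member of the family extends \<open>M\<close> to a matroid whose flats are those of \<open>M\<close> and the members of the
  family (\<open>matroid_erection\<close>, \<open>flats_erection\<close>). As a matroid is determined by its flats, this is the
  free erection (\<open>free_erection_eq_erection\<close>).
\<close>

section \<open>Independence, rank and flats\<close>

lemma matroid_finite_ground: "matroid M \<Longrightarrow> finite (ground M)"
  by (simp add: matroid_def)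

lemma indep_subset_ground: "matroid M \<Longrightarrow> I \<in> indeps M \<Longrightarrow> I \<subseteq> ground M"
  by (auto simp: matroid_def)

lemma indep_finite: "matroid M \<Longrightarrow> I \<in> indeps M \<Longrightarrow> finite I"
  using matroid_finite_ground indep_subset_ground finite_subset by metis

lemma indep_empty: "matroid M \<Longrightarrow> {} \<in> indeps M"
  by (simp add: matroid_def)

lemma indep_mono: "matroid M \<Longrightarrow> J \<in> indeps M \<Longrightarrow> I \<subseteq> J \<Longrightarrow> I \<in> indeps M"
  by (auto simp: matroid_def)

lemma indep_augment:
  assumes "matroid M" "I \<in> indeps M" "J \<in> indeps M" "card I < card J"
  obtains x where "x \<in> J" "x \<notin> I" "insert x I \<in> indeps M"
proof -
  have "\<exists>x\<in>J - I. insert x I \<in> indeps M"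
    using assms by (simp add: matroid_def)
  then show thesis using that by blast
qed

lemma indep_extend:
  assumes M: "matroid M" and I: "I \<in> indeps M" and J: "J \<in> indeps M"
    and k: "card I \<le> k" "k \<le> card J"
  obtains K where "K \<in> indeps M" "I \<subseteq> K" "K \<subseteq> I \<union> J" "card K = k"
proof -
  have "\<exists>K\<in>indeps M. I \<subseteq> K \<and> K \<subseteq> I \<union> J \<and> card K = k"
    using k
  proof (induction k rule: dec_induct)
    case base
    then show ?case using I by blast
  next
    case (step n)
    then obtain K where K: "K \<in> indeps M" "I \<subseteq> K" "K \<subseteq> I \<union> J" "card K = n" by auto
    with step.prems have "card K < card J" by simp
    then obtain x where x: "x \<in> J" "x \<notin> K" "insert x K \<in> indeps M"
      using indep_augment[OF M K(1) J] by blast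
    then have "card (insert x K) = Suc n"
      using K indep_finite[OF M] by simp
    then show ?case using x K by (intro bexI[of _ "insert x K"]) auto
  qed
  then show thesis using that by blast
qed

lemma finite_indeps_within: "matroid M \<Longrightarrow> finite {I \<in> indeps M. I \<subseteq> X}"
  by (rule finite_subset[of _ "Pow (ground M)"])
    (auto dest: indep_subset_ground matroid_finite_ground)

lemma card_le_rank_of:
  assumes "matroid M" "I \<in> indeps M" "I \<subseteq> X"
  shows "card I \<le> rank_of M X"
  unfolding rank_of_def using assms finite_indeps_within[of M X] by (intro Max_ge) auto

lemma rank_of_basis:
  assumes "matroid M"
  obtains B where "B \<in> indeps M" "B \<subseteq> X" "card B = rank_of M X"
proof -
  have "rank_of M X \<in> card ` {I \<in> indeps M. I \<subseteq> X}"
    unfolding rank_of_def using assms finite_indeps_within[of M X] indep_empty[of M]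
    by (intro Max_in) auto
  then show thesis using that by auto
qed

lemma rank_of_mono: "matroid M \<Longrightarrow> X \<subseteq> Y \<Longrightarrow> rank_of M X \<le> rank_of M Y"
  by (metis rank_of_basis card_le_rank_of subset_trans)

lemma indep_in_rank:
  assumes M: "matroid M" and k: "k \<le> rank_of M X"
  obtains I where "I \<in> indeps M" "I \<subseteq> X" "card I = k"
proof -
  obtain B where B: "B \<in> indeps M" "B \<subseteq> X" "card B = rank_of M X"
    using rank_of_basis[OF M] .
  obtain I where "I \<subseteq> B" "card I = k" using obtain_subset_with_card_n k B(3) by metis
  then show thesis using that B indep_mono[OF M B(1)] by blast
qed

text \<open>
  A basis of \<open>F\<close> extends any independent \<open>I \<subseteq> F\<close>, and it stays independent after adding a
  point outside a flat. In this form flats can be handled without computing ranks.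
\<close>

lemma flats_iff:
  assumes M: "matroid M"
  shows "F \<in> flats M \<longleftrightarrow> F \<subseteq> ground M \<and>
    (\<forall>x\<in>ground M - F. \<forall>I\<in>indeps M. I \<subseteq> F \<longrightarrow> insert x I \<in> indeps M)"
proof -
  have "rank_of M F < rank_of M (insert x F) \<longleftrightarrow>
      (\<forall>I\<in>indeps M. I \<subseteq> F \<longrightarrow> insert x I \<in> indeps M)" if x: "x \<notin> F" for x
  proof
    assume less: "rank_of M F < rank_of M (insert x F)"
    show "\<forall>I\<in>indeps M. I \<subseteq> F \<longrightarrow> insert x I \<in> indeps M"
    proof (intro ballI impI)
      fix I assume I: "I \<in> indeps M" "I \<subseteq> F"
      obtain B where B: "B \<in> indeps M" "B \<subseteq> insert x F" "card B = rank_of M (insert x F)"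
        using rank_of_basis[OF M] .
      have "card I \<le> card B" using card_le_rank_of[OF M I] less B(3) by simp
      then obtain K where K: "K \<in> indeps M" "I \<subseteq> K" "K \<subseteq> I \<union> B" "card K = card B"
        using indep_extend[OF M I(1) B(1)] by blast
      have "x \<in> K"
      proof (rule ccontr)
        assume "x \<notin> K"
        then have "K \<subseteq> F" using K(3) I(2) B(2) by blast
        then have "card K \<le> rank_of M F" by (rule card_le_rank_of[OF M K(1)])
        then show False using K(4) B(3) less by simp
      qed
      then show "insert x I \<in> indeps M" using indep_mono[OF M K(1)] K(2) by blast
    qed
  next
    assume ins: "\<forall>I\<in>indeps M. I \<subseteq> F \<longrightarrow> insert x I \<in> indeps M"
    obtain B where B: "B \<in> indeps M" "B \<subseteq> F" "card B = rank_of M F"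
      using rank_of_basis[OF M] .
    have "insert x B \<in> indeps M" using ins B by blast
    then have "card (insert x B) \<le> rank_of M (insert x F)"
      using card_le_rank_of[OF M] B(2) by blast
    moreover have "x \<notin> B" using x B(2) by blast
    ultimately show "rank_of M F < rank_of M (insert x F)"
      using B(3) card_insert_disjoint[OF indep_finite[OF M B(1)] \<open>x \<notin> B\<close>] by simp
  qed
  then have "(\<forall>x\<in>ground M - F. rank_of M F < rank_of M (insert x F)) \<longleftrightarrow>
      (\<forall>x\<in>ground M - F. \<forall>I\<in>indeps M. I \<subseteq> F \<longrightarrow> insert x I \<in> indeps M)"
    by (intro ball_cong refl) simp
  then show ?thesis by (simp add: flats_def)
qed

lemma flats_of_rankD:
  assumes "F \<in> flats_of_rank k M"
  shows "F \<in> flats M" "rank_of M F = k" "F \<subseteq> ground M"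
  using assms by (auto simp: flats_of_rank_def flats_def)

lemma flat_of_rank_basis:
  assumes M: "matroid M" and F: "F \<in> flats_of_rank k M"
  obtains I where "I \<in> indeps M" "I \<subseteq> F" "card I = k"
  using rank_of_basis[OF M, of F] flats_of_rankD(2)[OF F] by metis

text \<open>A set of rank at most \<open>k\<close> lies in the closure of any independent \<open>k\<close>-set that it contains.\<close>

lemma flat_absorbs_set_of_same_rank:
  assumes M: "matroid M" and F: "F \<in> flats_of_rank k M"
    and X: "X \<subseteq> ground M" "rank_of M X \<le> k"
    and I: "I \<in> indeps M" "card I = k" "I \<subseteq> F" "I \<subseteq> X"
  shows "X \<subseteq> F"
proof
  fix x assume x: "x \<in> X"
  show "x \<in> F"
  proof (rule ccontr)
    assume "x \<notin> F"
    then have "insert x I \<in> indeps M"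
      using flats_of_rankD(1)[OF F] flats_iff[OF M] x X(1) I by blast
    then have "card (insert x I) \<le> k"
      using card_le_rank_of[OF M, of "insert x I" X] x I X(2) by simp
    moreover have "x \<notin> I" using \<open>x \<notin> F\<close> I(3) by blast
    ultimately show False using I(2) indep_finite[OF M I(1)] by simp
  qed
qed

lemma flats_of_rank_eqI:
  assumes M: "matroid M" and "F \<in> flats_of_rank k M" "G \<in> flats_of_rank k M"
    and "I \<in> indeps M" "card I = k" "I \<subseteq> F" "I \<subseteq> G"
  shows "F = G"
proof (rule subset_antisym)
  show "F \<subseteq> G"
    using flat_absorbs_set_of_same_rank[OF M assms(3), of F I] flats_of_rankD(2,3)[OF assms(2)] assms(4-7)
    by simp
  show "G \<subseteq> F"
    using flat_absorbs_set_of_same_rank[OF M assms(2), of G I] flats_of_rankD(2,3)[OF assms(3)] assms(4-7)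
    by simp
qed

text \<open>
  The closure of \<open>I\<close> consists of the points of \<open>I\<close> and those that make \<open>I\<close> dependent. An independent
  subset with more elements than \<open>I\<close> would augment \<open>I\<close> by a point of the closure.
\<close>

lemma exists_closure:
  assumes M: "matroid M" and I: "I \<in> indeps M"
  obtains F where "F \<in> flats_of_rank (card I) M" "I \<subseteq> F"
    "\<And>x. x \<in> ground M \<Longrightarrow> insert x I \<notin> indeps M \<Longrightarrow> x \<in> F"
    "\<And>x. x \<in> F \<Longrightarrow> x \<notin> I \<Longrightarrow> insert x I \<notin> indeps M"
proof -
  define F where "F = {y \<in> ground M. y \<in> I \<or> insert y I \<notin> indeps M}"
  have IF: "I \<subseteq> F" using indep_subset_ground[OF M I] by (auto simp: F_def)
  have bound: "card J \<le> card I" if J: "J \<in> indeps M" "J \<subseteq> F" for J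
  proof (rule ccontr)
    assume "\<not> card J \<le> card I"
    then have "card I < card J" by simp
    then obtain x where "x \<in> J" "x \<notin> I" "insert x I \<in> indeps M"
      by (rule indep_augment[OF M I J(1)])
    then show False using J(2) by (auto simp: F_def)
  qed
  have rank: "rank_of M F = card I"
    using bound card_le_rank_of[OF M I IF] rank_of_basis[OF M] by (metis le_antisym)
  have "F \<in> flats M"
    unfolding flats_def
  proof (intro CollectI conjI ballI)
    show "F \<subseteq> ground M" by (auto simp: F_def)
    fix x assume x: "x \<in> ground M - F"
    then have "x \<notin> I" "insert x I \<in> indeps M" by (auto simp: F_def)
    then have "Suc (card I) \<le> rank_of M (insert x F)"
      using card_le_rank_of[OF M, of "insert x I" "insert x F"] IF indep_finite[OF M I]
      by (simp add: subset_insertI2)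
    then show "rank_of M F < rank_of M (insert x F)" using rank by simp
  qed
  then have "F \<in> flats_of_rank (card I) M" using rank by (simp add: flats_of_rank_def)
  then show thesis using that IF by (auto simp: F_def)
qed

lemma exists_flat_of_rank_above:
  assumes M: "matroid M" and A: "A \<subseteq> ground M" "rank_of M A \<le> k" and k: "k \<le> matroid_rank M"
  obtains F where "F \<in> flats_of_rank k M" "A \<subseteq> F"
proof -
  obtain B where B: "B \<in> indeps M" "B \<subseteq> A" "card B = rank_of M A"
    using rank_of_basis[OF M] .
  obtain G where G: "G \<in> indeps M" "card G = k"
    using indep_in_rank[OF M] k unfolding matroid_rank_def by metis
  obtain K where K: "K \<in> indeps M" "B \<subseteq> K" "card K = k"
    using indep_extend[OF M B(1) G(1), of k] A(2) B(3) G(2) by (metis order_refl)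
  obtain F where F: "F \<in> flats_of_rank (card K) M" "K \<subseteq> F"
    "\<And>x. x \<in> ground M \<Longrightarrow> insert x K \<notin> indeps M \<Longrightarrow> x \<in> F"
    using exists_closure[OF M K(1)] by metis
  have "A \<subseteq> F"
  proof
    fix x assume x: "x \<in> A"
    show "x \<in> F"
    proof (cases "x \<in> B")
      case True
      then show ?thesis using K(2) F(2) by blast
    next
      case False
      have "insert x B \<notin> indeps M"
      proof
        assume "insert x B \<in> indeps M"
        then have "card (insert x B) \<le> rank_of M A"
          using card_le_rank_of[OF M] x B(2) by blast
        then show False using False B(3) indep_finite[OF M B(1)] by simp
      qed
      then have "insert x K \<notin> indeps M" using indep_mono[OF M] K(2) by blast
      then show ?thesis using F(3) x A(1) by blast
    qed
  qed
  then show thesis using that F(1) K(3) by blast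
qed

text \<open>
  A set is independent exactly when each of its points is separated from the others by a flat:
  in one direction the closure of the other points separates, and in the other a point outside a
  maximal independent subset could not be separated.
\<close>

lemma indep_iff_separated_by_flats:
  assumes M: "matroid M"
  shows "I \<in> indeps M \<longleftrightarrow>
    I \<subseteq> ground M \<and> (\<forall>x\<in>I. \<exists>F\<in>flats M. I - {x} \<subseteq> F \<and> x \<notin> F)"
proof (intro iffI conjI ballI)
  assume I: "I \<in> indeps M"
  then show "I \<subseteq> ground M" by (rule indep_subset_ground[OF M])
  fix x assume x: "x \<in> I"
  have "I - {x} \<in> indeps M" using indep_mono[OF M I] by blast
  then obtain F where F: "F \<in> flats_of_rank (card (I - {x})) M" "I - {x} \<subseteq> F"
    "\<And>y. y \<in> F \<Longrightarrow> y \<notin> I - {x} \<Longrightarrow> insert y (I - {x}) \<notin> indeps M"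
    using exists_closure[OF M] by metis
  have "x \<notin> F" using F(3)[of x] x I by (auto simp: insert_absorb)
  then show "\<exists>F\<in>flats M. I - {x} \<subseteq> F \<and> x \<notin> F" using F(2) flats_of_rankD(1)[OF F(1)] by blast
next
  assume I: "I \<subseteq> ground M \<and> (\<forall>x\<in>I. \<exists>F\<in>flats M. I - {x} \<subseteq> F \<and> x \<notin> F)"
  obtain B where B: "B \<in> indeps M" "B \<subseteq> I" "card B = rank_of M I"
    using rank_of_basis[OF M] .
  have "I \<subseteq> B"
  proof
    fix x assume x: "x \<in> I"
    show "x \<in> B"
    proof (rule ccontr)
      assume xB: "x \<notin> B"
      obtain F where "F \<in> flats M" "I - {x} \<subseteq> F" "x \<notin> F" using I x by blast
      moreover have "x \<in> ground M" using x I by blast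
      moreover have "B \<subseteq> F" using B(2) xB \<open>I - {x} \<subseteq> F\<close> by blast
      ultimately have "insert x B \<in> indeps M" using flats_iff[OF M, of F] B(1) by blast
      then have "card (insert x B) \<le> rank_of M I"
        using card_le_rank_of[OF M] x B(2) by blast
      then show False using xB B(3) indep_finite[OF M B(1)] by simp
    qed
  qed
  then show "I \<in> indeps M" using B(1,2) by (simp add: subset_antisym)
qed

lemma matroid_eqI_flats:
  fixes M N :: "'a set_system"
  assumes "matroid M" "matroid N" "ground M = ground N" "flats M = flats N"
  shows "M = N"
proof -
  have "indeps M = indeps N"
    using indep_iff_separated_by_flats[OF assms(1)] indep_iff_separated_by_flats[OF assms(2)] assms(3,4)
    by (intro set_eqI) simp
  then show ?thesis using assms(3) by simp
qed

lemma rank_of_cong: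
  assumes M: "matroid M" and N: "matroid N"
    and agree: "\<And>I. card I \<le> k \<Longrightarrow> I \<in> indeps M \<longleftrightarrow> I \<in> indeps N"
    and "rank_of M X < k"
  shows "rank_of N X = rank_of M X"
proof -
  have le: "rank_of N X < k"
  proof (rule ccontr)
    assume "\<not> rank_of N X < k"
    then have "k \<le> rank_of N X" by simp
    then obtain I where I: "I \<in> indeps N" "I \<subseteq> X" "card I = k"
      by (rule indep_in_rank[OF N])
    then have "k \<le> rank_of M X" using card_le_rank_of[OF M, of I X] agree by auto
    then show False using assms(4) by simp
  qed
  obtain B where B: "B \<in> indeps M" "B \<subseteq> X" "card B = rank_of M X" using rank_of_basis[OF M] .
  obtain C where C: "C \<in> indeps N" "C \<subseteq> X" "card C = rank_of N X" using rank_of_basis[OF N] .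
  have "B \<in> indeps N" "C \<in> indeps M" using agree B C le assms(4) by simp_all
  then show ?thesis
    using card_le_rank_of[OF M _ C(2)] card_le_rank_of[OF N _ B(2)] B(3) C(3) by simp
qed

text \<open>
  Whether a set of rank below \<open>k\<close> is a flat is decided by independent sets of at most \<open>k\<close> elements.
\<close>

lemma flats_of_rank_cong:
  assumes M: "matroid M" and N: "matroid N" and ground: "ground M = ground N"
    and agree: "\<And>I. card I \<le> k \<Longrightarrow> I \<in> indeps M \<longleftrightarrow> I \<in> indeps N"
    and "j < k"
  shows "flats_of_rank j M = flats_of_rank j N"
proof -
  have "F \<in> flats_of_rank j N"
    if M: "matroid M" and N: "matroid N" and ground: "ground M = ground N"
      and agree: "\<And>I. card I \<le> k \<Longrightarrow> I \<in> indeps M \<longleftrightarrow> I \<in> indeps N"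
      and F: "F \<in> flats_of_rank j M" for M N :: "'a set_system" and F
  proof -
    have rank: "rank_of N F = j"
      using rank_of_cong[OF M N agree] flats_of_rankD(2)[OF F] \<open>j < k\<close> by simp
    have "insert x I \<in> indeps N" if x: "x \<in> ground N - F" and I: "I \<in> indeps N" "I \<subseteq> F" for x I
    proof -
      have "card I < k" using card_le_rank_of[OF N I] rank \<open>j < k\<close> by simp
      moreover have "card (insert x I) \<le> Suc (card I)" by (simp add: card_insert_le_m1 card_insert_if)
      moreover have "insert x I \<in> indeps M" if "I \<in> indeps M"
        using flats_of_rankD(1)[OF F] flats_iff[OF M] x that I(2) ground by auto
      ultimately show ?thesis using agree I(1) by (meson Suc_leI less_imp_le order_trans)
    qed
    then have "F \<in> flats N"
      using flats_iff[OF N] flats_of_rankD(3)[OF F] ground by auto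
    then show ?thesis using rank by (simp add: flats_of_rank_def)
  qed
  then show ?thesis using assms(1-4) by (metis subset_antisym subsetI)
qed

lemma simple_matroid_card_le_whitney_1:
  assumes "simple_matroid M"
  shows "card (ground M) \<le> whitney 1 M"
proof -
  have M: "matroid M" using assms by (simp add: simple_matroid_def)
  have small: "X \<in> indeps M" if "X \<subseteq> ground M" "card X \<le> 2" for X
    using assms that by (simp add: simple_matroid_def)
  have "\<exists>F\<in>flats_of_rank 1 M. x \<in> F" if "x \<in> ground M" for x
    using exists_closure[OF M small[of "{x}"]] that by (metis card_1_singleton_iff One_nat_def
        empty_subsetI insert_subset one_le_numeral)
  then obtain f where f: "\<And>x. x \<in> ground M \<Longrightarrow> f x \<in> flats_of_rank 1 M \<and> x \<in> f x" by metis
  have "inj_on f (ground M)"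
  proof (rule inj_onI, rule ccontr)
    fix x y assume xy: "x \<in> ground M" "y \<in> ground M" "f x = f y" "x \<noteq> y"
    have "{x, y} \<in> indeps M" using small[of "{x, y}"] xy by simp
    moreover have "{x, y} \<subseteq> f x" using f[OF xy(1)] f[OF xy(2)] xy(3) by simp
    ultimately have "card {x, y} \<le> rank_of M (f x)" by (rule card_le_rank_of[OF M])
    moreover have "rank_of M (f x) = 1" using flats_of_rankD(2) f[OF xy(1)] by blast
    ultimately show False using xy(4) by simp
  qed
  moreover have "finite (flats_of_rank 1 M)"
    by (rule finite_subset[of _ "Pow (ground M)"])
      (auto dest: flats_of_rankD(3) simp: matroid_finite_ground[OF M])
  ultimately show ?thesis unfolding whitney_def using f by (intro card_inj_on_le[of f]) auto
qed


section \<open>The points-lines-planes property under specialization\<close>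

text \<open>
  With the same points and lines, a freer matroid has at least as many planes, hence the stronger
  inequality. The proof rests on the surjection \<open>g\<close> from the planes of \<open>E\<close> to those of \<open>N\<close>.
\<close>

lemma points_lines_planes_specialize:
  assumes E: "simple_matroid E" and N: "simple_matroid N" and rank: "4 \<le> matroid_rank N"
    and ground: "ground E = ground N"
    and agree: "\<And>I. card I \<le> 3 \<Longrightarrow> I \<in> indeps E \<longleftrightarrow> I \<in> indeps N"
    and freer: "indeps N \<subseteq> indeps E"
    and plp: "points_lines_planes E"
  shows "points_lines_planes N"
proof -
  define S where "S = ground N"
  define triples where "triples = {X. X \<subseteq> S \<and> card X = 3}"
  let ?PE = "flats_of_rank 3 E" and ?PN = "flats_of_rank 3 N"
  have mE: "matroid E" and mN: "matroid N"
    using E N by (simp_all add: simple_matroid_def)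
  have finS: "finite S" using matroid_finite_ground[OF mN] by (simp add: S_def)
  have finE: "finite ?PE"
    using finS flats_of_rankD(3)[of _ 3 E] ground
    by (intro finite_subset[of ?PE "Pow S"]) (simp_all add: S_def subset_iff)
  have low: "whitney j E = whitney j N" if "j < 3" for j
    unfolding whitney_def
    using flats_of_rank_cong[OF mE mN ground agree that] by simp

  have in_plane: "\<exists>X\<in>?PN. Y \<subseteq> X" if Y: "Y \<in> ?PE" for Y
  proof -
    obtain T where T: "T \<in> indeps E" "T \<subseteq> Y" "card T = 3" using flat_of_rank_basis[OF mE Y] .
    then have TN: "T \<in> indeps N" using agree by simp
    obtain X where X: "X \<in> ?PN" "T \<subseteq> X"
      "\<And>x. x \<in> ground N \<Longrightarrow> insert x T \<notin> indeps N \<Longrightarrow> x \<in> X"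
      using exists_closure[OF mN TN] T(3) by metis
    have "Y \<subseteq> X"
    proof
      fix y assume y: "y \<in> Y"
      show "y \<in> X"
      proof (cases "y \<in> T")
        case False
        have "insert y T \<notin> indeps E"
        proof
          assume "insert y T \<in> indeps E"
          then have "card (insert y T) \<le> 3"
            using card_le_rank_of[OF mE, of "insert y T" Y] y T(2) flats_of_rankD(2)[OF Y] by simp
          then show False using False T(3) indep_finite[OF mE T(1)] by simp
        qed
        then have "insert y T \<notin> indeps N" using freer by blast
        then show ?thesis using X(3) y flats_of_rankD(3)[OF Y] ground by blast
      qed (use X(2) in blast)
    qed
    then show ?thesis using X(1) by blast
  qed
  then obtain g where g: "\<And>Y. Y \<in> ?PE \<Longrightarrow> g Y \<in> ?PN" "\<And>Y. Y \<in> ?PE \<Longrightarrow> Y \<subseteq> g Y" by metis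
  have g_eq: "g Y = X" if Y: "Y \<in> ?PE" and X: "X \<in> ?PN"
    and T: "T \<in> indeps N" "card T = 3" "T \<subseteq> Y" "T \<subseteq> X" for X Y T
    using flats_of_rank_eqI[OF mN g(1)[OF Y] X T(1,2)] g(2)[OF Y] T(3,4) by blast
  have surj: "g ` ?PE = ?PN"
  proof (intro subset_antisym subsetI)
    fix X assume X: "X \<in> ?PN"
    obtain T where T: "T \<in> indeps N" "T \<subseteq> X" "card T = 3" using flat_of_rank_basis[OF mN X] .
    then have "T \<in> indeps E" using freer by blast
    then obtain Y where "Y \<in> ?PE" "T \<subseteq> Y" using exists_closure[OF mE] T(3) by metis
    then show "X \<in> g ` ?PE" using g_eq[OF _ X T(1,3) _ T(2)] by blast
  qed (use g in blast)
  have W3: "whitney 3 N \<le> whitney 3 E"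
    unfolding whitney_def using card_image_le[OF finE, of g] surj by simp

  have triple_indep: "X \<in> indeps K" if K: "matroid K" "X \<in> flats_of_rank 3 K" and X: "X \<in> triples"
    for K :: "'a set_system" and X
  proof -
    obtain T where "T \<in> indeps K" "T \<subseteq> X" "card T = 3"
      using flat_of_rank_basis[OF K] .
    moreover have "finite X" using X finS finite_subset by (auto simp: triples_def)
    ultimately show ?thesis using X card_subset_eq[of X T] by (simp add: triples_def)
  qed

  \<comment> \<open>From right to left, equal cardinalities turn the surjection \<open>g\<close> into a bijection.\<close>
  have triples_iff: "?PN = triples \<longleftrightarrow> ?PE = triples \<and> whitney 3 N = whitney 3 E"
  proof
    assume PN: "?PN = triples"
    have "Y \<in> triples" if Y: "Y \<in> ?PE" for Y
    proof -
      obtain T where T: "T \<in> indeps E" "T \<subseteq> Y" "card T = 3" using flat_of_rank_basis[OF mE Y] .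
      have gY: "g Y \<in> triples" using g(1)[OF Y] PN by simp
      then have fin: "finite (g Y)" using finS finite_subset by (auto simp: triples_def)
      have "T = g Y"
        using card_subset_eq[OF fin, of T] T g(2)[OF Y] gY by (simp add: triples_def subset_trans)
      then have "Y = g Y" using T(2) g(2)[OF Y] by blast
      then show ?thesis using gY by simp
    qed
    moreover have "T \<in> ?PE" if T: "T \<in> triples" for T
    proof -
      have TN: "T \<in> indeps N" using triple_indep[OF mN] T PN by simp
      then have "T \<in> indeps E" using freer by blast
      moreover have "card T = 3" using T by (simp add: triples_def)
      ultimately obtain Y where Y: "Y \<in> ?PE" "T \<subseteq> Y" using exists_closure[OF mE] by metis
      have "g Y = T" using g_eq[OF Y(1) _ TN \<open>card T = 3\<close> Y(2)] T PN by simp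
      then show ?thesis using Y g(2)[OF Y(1)] by (metis subset_antisym)
    qed
    ultimately have "?PE = triples" by blast
    then show "?PE = triples \<and> whitney 3 N = whitney 3 E" using PN by (simp add: whitney_def)
  next
    assume A: "?PE = triples \<and> whitney 3 N = whitney 3 E"
    then have PE: "?PE = triples" by simp
    have "card (g ` ?PE) = card ?PE" using A surj by (simp add: whitney_def)
    then have inj: "inj_on g ?PE" using eq_card_imp_inj_on[OF finE] by blast
    have indep: "T \<in> indeps N" if "T \<in> triples" for T
      using triple_indep[OF mE, of T] that PE agree by (simp add: triples_def)
    have PN_sub: "X \<in> triples" if X: "X \<in> ?PN" for X
    proof -
      obtain T where T: "T \<in> indeps N" "T \<subseteq> X" "card T = 3" using flat_of_rank_basis[OF mN X] .
      have XS: "X \<subseteq> S" using flats_of_rankD(3)[OF X] by (simp add: S_def)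
      have "T \<in> triples" using T XS by (auto simp: triples_def)
      \<comment> \<open>A fourth point of \<open>X\<close> would give a second triple that \<open>g\<close> maps to \<open>X\<close>.\<close>
      have "X \<subseteq> T"
      proof
        fix x assume x: "x \<in> X"
        show "x \<in> T"
        proof (rule ccontr)
          assume xT: "x \<notin> T"
          obtain t where t: "t \<in> T" using T(3) by (metis card.empty ex_in_conv zero_neq_numeral)
          let ?U = "insert x (T - {t})"
          have "card ?U = 3"
            using xT t T(3) indep_finite[OF mN T(1)] by simp
          then have U: "?U \<in> triples" "?U \<subseteq> X"
            using x T(2) XS by (auto simp: triples_def)
          have "g T = X" "g ?U = X"
            using g_eq[of T X T] g_eq[of ?U X ?U] T X U indep \<open>T \<in> triples\<close> \<open>card ?U = 3\<close> PE
            by auto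
          then have "T = ?U" using inj_onD[OF inj] PE \<open>T \<in> triples\<close> U(1) by simp
          then show False using xT by blast
        qed
      qed
      then show ?thesis using T \<open>T \<in> triples\<close> by (simp add: subset_antisym)
    qed
    have "T \<in> ?PN" if T: "T \<in> triples" for T
    proof -
      have "g T \<in> ?PN" "T \<subseteq> g T" using g T PE by auto
      moreover have "finite (g T)"
        using PN_sub[OF \<open>g T \<in> ?PN\<close>] finS finite_subset[of "g T" S] by (simp add: triples_def)
      ultimately have "T = g T"
        using card_subset_eq[of "g T" T] PN_sub T by (simp add: triples_def)
      then show ?thesis using \<open>g T \<in> ?PN\<close> by simp
    qed
    then show "?PN = triples" using PN_sub by blast
  qed

  have "4 \<le> card S"
  proof -
    obtain B where "B \<in> indeps N" "B \<subseteq> S" "card B = 4"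
      using indep_in_rank[OF mN] rank unfolding matroid_rank_def S_def by metis
    then show ?thesis using card_mono[OF finS] by metis
  qed
  then have W1: "4 \<le> whitney 1 N" using simple_matroid_card_le_whitney_1[OF N] by (simp add: S_def)
  define c where "c = 3 * (real (whitney 1 N) - 1) / (2 * (real (whitney 1 N) - 2)) * real (whitney 1 N)"
  \<comment> \<open>Strict positivity is what makes equal bounds force equal numbers of planes.\<close>
  have c: "0 < c" using W1 by (simp add: c_def)
  let ?W2 = "(real (whitney 2 N))\<^sup>2"
  have PE: "c * real (whitney 3 E) \<le> ?W2" "?W2 = c * real (whitney 3 E) \<longleftrightarrow> ?PE = triples"
    using plp low[of 1] low[of 2] ground
    by (simp_all add: points_lines_planes_def Let_def c_def triples_def S_def)
  have le: "c * real (whitney 3 N) \<le> c * real (whitney 3 E)" using W3 c by simp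
  have "?W2 = c * real (whitney 3 N) \<longleftrightarrow> ?PE = triples \<and> whitney 3 N = whitney 3 E"
  proof
    assume eq: "?W2 = c * real (whitney 3 N)"
    then have eq': "c * real (whitney 3 N) = c * real (whitney 3 E)" using PE(1) le by linarith
    then have "whitney 3 N = whitney 3 E" using c by simp
    then show "?PE = triples \<and> whitney 3 N = whitney 3 E" using PE(2) eq eq' by simp
  qed (use PE(2) in simp)
  then show ?thesis
    using triples_iff PE(1) le
    by (simp add: points_lines_planes_def Let_def c_def triples_def S_def)
qed


section \<open>Erections of a matroid of rank three\<close>

text \<open>
  What a family of sets must satisfy to be the planes of an erection of \<open>M\<close>. Incidence is phrased
  through independent triples, the noncollinear ones. The family \<open>{ground M}\<close> is admitted: it yields
  the trivial erection, so that one construction serves all cases.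
\<close>

definition erection_family :: "'a set_system \<Rightarrow> 'a set set \<Rightarrow> bool" where
  "erection_family M P \<longleftrightarrow>
     (\<forall>X\<in>P. X \<subseteq> ground M \<and> (\<exists>T\<in>indeps M. T \<subseteq> X \<and> card T = 3)) \<and>
     (\<forall>l\<in>flats_of_rank 2 M. \<forall>a\<in>ground M - l. \<exists>X\<in>P. insert a l \<subseteq> X) \<and>
     (\<forall>X\<in>P. \<forall>Y\<in>P. \<forall>T\<in>indeps M. T \<subseteq> X \<inter> Y \<and> card T = 3 \<longrightarrow> X = Y)"

lemma erection_familyD:
  assumes "erection_family M P"
  shows "X \<in> P \<Longrightarrow> X \<subseteq> ground M"
    and "X \<in> P \<Longrightarrow> \<exists>T\<in>indeps M. T \<subseteq> X \<and> card T = 3"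
    and "l \<in> flats_of_rank 2 M \<Longrightarrow> a \<in> ground M \<Longrightarrow> a \<notin> l \<Longrightarrow> \<exists>X\<in>P. insert a l \<subseteq> X"
    and "X \<in> P \<Longrightarrow> Y \<in> P \<Longrightarrow> T \<in> indeps M \<Longrightarrow> card T = 3 \<Longrightarrow> T \<subseteq> X \<Longrightarrow> T \<subseteq> Y \<Longrightarrow> X = Y"
  using assms unfolding erection_family_def by (metis, metis, metis DiffI, metis Int_greatest)

definition erection :: "'a set_system \<Rightarrow> 'a set set \<Rightarrow> 'a set_system" where
  "erection M P = \<lparr>ground = ground M,
     indeps = indeps M \<union> {I. I \<subseteq> ground M \<and> card I = 4 \<and> (\<forall>X\<in>P. \<not> I \<subseteq> X)}\<rparr>"

lemma ground_erection [simp]: "ground (erection M P) = ground M"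
  by (simp add: erection_def)

lemma indeps_erection: "I \<in> indeps (erection M P) \<longleftrightarrow>
    I \<in> indeps M \<or> I \<subseteq> ground M \<and> card I = 4 \<and> (\<forall>X\<in>P. \<not> I \<subseteq> X)"
  by (simp add: erection_def)

lemma noncollinear_iff:
  assumes M: "matroid M" "matroid_rank M = 3" and A: "A \<subseteq> ground M"
  shows "(\<forall>l\<in>flats_of_rank 2 M. \<not> A \<subseteq> l) \<longleftrightarrow> (\<exists>T\<in>indeps M. T \<subseteq> A \<and> card T = 3)"
proof
  assume L: "\<forall>l\<in>flats_of_rank 2 M. \<not> A \<subseteq> l"
  have "\<not> rank_of M A \<le> 2"
    using exists_flat_of_rank_above[OF M(1) A, of 2] L M(2) by auto
  then have "3 \<le> rank_of M A" by simp
  then show "\<exists>T\<in>indeps M. T \<subseteq> A \<and> card T = 3" using indep_in_rank[OF M(1)] by metis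
next
  assume "\<exists>T\<in>indeps M. T \<subseteq> A \<and> card T = 3"
  then obtain T where T: "T \<in> indeps M" "T \<subseteq> A" "card T = 3" by blast
  show "\<forall>l\<in>flats_of_rank 2 M. \<not> A \<subseteq> l"
  proof (intro ballI notI)
    fix l assume l: "l \<in> flats_of_rank 2 M" "A \<subseteq> l"
    then have "card T \<le> rank_of M l" using card_le_rank_of[OF M(1) T(1)] T(2) by blast
    then show False using flats_of_rankD(2)[OF l(1)] T(3) by simp
  qed
qed

text \<open>
  A noncollinear triple is contained in the union of the line through two of its points with the third.
\<close>

lemma indep_triple_in_member:
  assumes M: "matroid M" "matroid_rank M = 3" and P: "erection_family M P"
    and T: "T \<in> indeps M" "card T = 3"
  obtains X where "X \<in> P" "T \<subseteq> X"
proof -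
  obtain c where c: "c \<in> T" using T(2) by (metis card.empty ex_in_conv zero_neq_numeral)
  have TS: "T \<subseteq> ground M" by (rule indep_subset_ground[OF M(1) T(1)])
  have card2: "card (T - {c}) = 2" using T c indep_finite[OF M(1) T(1)] by simp
  have "\<not> (\<exists>U\<in>indeps M. U \<subseteq> T - {c} \<and> card U = 3)"
  proof
    assume "\<exists>U\<in>indeps M. U \<subseteq> T - {c} \<and> card U = 3"
    then obtain U where "U \<subseteq> T - {c}" "card U = 3" by blast
    then show False using card_mono[of "T - {c}" U] card2 indep_finite[OF M(1) T(1)] by simp
  qed
  then obtain l where l: "l \<in> flats_of_rank 2 M" "T - {c} \<subseteq> l"
    using noncollinear_iff[OF M, of "T - {c}"] TS by blast
  have "\<not> T \<subseteq> l" using noncollinear_iff[OF M TS] T l(1) by blast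
  then have "c \<in> ground M" "c \<notin> l" using l(2) c TS by blast+
  then obtain X where "X \<in> P" "insert c l \<subseteq> X" using erection_familyD(3)[OF P l(1)] by blast
  then show thesis using that l(2) by blast
qed

lemma indep_card_le_3:
  assumes "matroid M" "matroid_rank M = 3" "I \<in> indeps M"
  shows "card I \<le> 3"
  using card_le_rank_of[OF assms(1,3) indep_subset_ground[OF assms(1,3)]] assms(2)
  by (simp add: matroid_rank_def)

lemma erection_card_le:
  assumes "matroid M" "matroid_rank M = 3" "I \<in> indeps (erection M P)"
  shows "card I \<le> 4"
  using assms(3) indep_card_le_3[OF assms(1,2), of I] by (auto simp: indeps_erection)

lemma indeps_erection_card_le_3:
  "card I \<le> 3 \<Longrightarrow> I \<in> indeps (erection M P) \<longleftrightarrow> I \<in> indeps M"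
  by (auto simp: indeps_erection)

text \<open>
  The condition on 4-sets in \<open>erection\<close> does not mention their triples. It excludes collinear ones
  nevertheless: a line through three of the points, together with one further point,
  contains all four and is covered by a member of \<open>P\<close>.
\<close>

lemma erection_new_subset:
  assumes M: "matroid M" "matroid_rank M = 3" and P: "erection_family M P"
    and J: "J \<subseteq> ground M" "card J = 4" "\<forall>X\<in>P. \<not> J \<subseteq> X"
    and T: "T \<subseteq> J" "card T = 3"
  shows "T \<in> indeps M"
proof -
  have TS: "T \<subseteq> ground M" using T J by blast
  have finJ: "finite J" using J(1) matroid_finite_ground[OF M(1)] finite_subset by blast
  have "\<not> T \<subseteq> l" if l: "l \<in> flats_of_rank 2 M" for l
  proof
    assume Tl: "T \<subseteq> l"
    have "card (J - T) = 1"
      using J(2) T finJ by (simp add: card_Diff_subset finite_subset)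
    then obtain x where x: "J - T = {x}" by (metis card_1_singletonE)
    have "\<exists>a\<in>ground M - l. J \<subseteq> insert a l"
    proof (cases "x \<in> l")
      case True
      have "l \<noteq> ground M" using flats_of_rankD(2)[OF l] M(2) by (auto simp: matroid_rank_def)
      then obtain a where "a \<in> ground M - l" using flats_of_rankD(3)[OF l] by blast
      moreover have "J \<subseteq> insert x T" using x by blast
      then have "J \<subseteq> l" using Tl True by blast
      ultimately show ?thesis by blast
    next
      case False
      then show ?thesis using x Tl J(1) by blast
    qed
    then obtain a where a: "a \<in> ground M" "a \<notin> l" "J \<subseteq> insert a l" by blast
    obtain X where "X \<in> P" "insert a l \<subseteq> X" using erection_familyD(3)[OF P l a(1,2)] by blast
    then show False using a(3) J(3) by blast
  qed
  then obtain U where U: "U \<in> indeps M" "U \<subseteq> T" "card U = 3"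
    using noncollinear_iff[OF M TS] by blast
  then have "U = T" using T finJ card_subset_eq[of T U] finite_subset by metis
  then show ?thesis using U by simp
qed

text \<open>
  The new case of augmentation is from a triple \<open>I\<close> to a 4-set \<open>J\<close>: the unique member of \<open>P\<close>
  containing \<open>I\<close> misses a point of \<open>J\<close>, and that point can be added.
\<close>

lemma matroid_erection:
  assumes M: "matroid M" "matroid_rank M = 3" and P: "erection_family M P"
  shows "matroid (erection M P)"
  unfolding matroid_def
proof (intro conjI ballI allI impI)
  let ?E = "erection M P"
  show "finite (ground ?E)" using matroid_finite_ground[OF M(1)] by simp
  show "indeps ?E \<subseteq> Pow (ground ?E)"
  proof
    fix I assume "I \<in> indeps ?E"
    then show "I \<in> Pow (ground ?E)"
      using indep_subset_ground[OF M(1), of I] by (auto simp: indeps_erection)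
  qed
  show "{} \<in> indeps ?E" using indep_empty[OF M(1)] by (simp add: indeps_erection)
  have new_sub: "I \<in> indeps M"
    if J: "J \<in> indeps ?E" "J \<notin> indeps M" and I: "I \<subseteq> J" "I \<noteq> J" for I J
  proof -
    have J': "J \<subseteq> ground M" "card J = 4" "\<forall>X\<in>P. \<not> J \<subseteq> X"
      using J by (auto simp: indeps_erection)
    then have finJ: "finite J" using matroid_finite_ground[OF M(1)] finite_subset by blast
    obtain x where x: "x \<in> J - I" using I by blast
    have "J - {x} \<in> indeps M"
      using erection_new_subset[OF M P J', of "J - {x}"] x J'(2) finJ by auto
    then show ?thesis using indep_mono[OF M(1)] I x by blast
  qed
  show "I \<in> indeps ?E" if "J \<in> indeps ?E" "I \<subseteq> J" for I J
    using new_sub[OF that(1) _ that(2)] that indep_mono[OF M(1)]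
    by (cases "J \<in> indeps M"; cases "I = J") (auto simp: indeps_erection)
  show "\<exists>x\<in>J - I. insert x I \<in> indeps ?E"
    if I: "I \<in> indeps ?E" and J: "J \<in> indeps ?E" and less: "card I < card J" for I J
  proof -
    have "card I < 4" using less erection_card_le[OF M J] by simp
    then have IM: "I \<in> indeps M" using I by (auto simp: indeps_erection)
    show ?thesis
    proof (cases "J \<in> indeps M")
      case True
      then show ?thesis using indep_augment[OF M(1) IM True less] by (auto simp: indeps_erection)
    next
      case False
      then have J': "J \<subseteq> ground M" "card J = 4" "\<forall>X\<in>P. \<not> J \<subseteq> X"
        using J by (auto simp: indeps_erection)
      then have finJ: "finite J" using matroid_finite_ground[OF M(1)] finite_subset by blast
      show ?thesis
      proof (cases "card I < 3")
        case True
        obtain T where T: "T \<subseteq> J" "card T = 3"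
          using obtain_subset_with_card_n[of 3 J] J'(2) by auto
        moreover from this have "T \<noteq> J" using J'(2) by auto
        ultimately have "T \<in> indeps M" using new_sub[OF J False] by simp
        then show ?thesis
          using indep_augment[OF M(1) IM, of T] \<open>T \<subseteq> J\<close> \<open>card T = 3\<close> True
          by (metis DiffI indeps_erection subsetD)
      next
        case False
        then have I3: "card I = 3" using \<open>card I < 4\<close> by simp
        obtain X where X: "X \<in> P" "I \<subseteq> X" using indep_triple_in_member[OF M P IM I3] .
        obtain x where x: "x \<in> J" "x \<notin> X" using J'(3) X(1) by blast
        have "\<not> insert x I \<subseteq> Y" if "Y \<in> P" for Y
        proof
          assume Y: "insert x I \<subseteq> Y"
          then have "X = Y" using erection_familyD(4)[OF P X(1) that IM I3 X(2)] by simp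
          then show False using Y x(2) by blast
        qed
        moreover have "card (insert x I) = 4"
          using x(2) X(2) I3 indep_finite[OF M(1) IM] by (auto simp: card_insert_if)
        moreover have "insert x I \<subseteq> ground M"
          using indep_subset_ground[OF M(1) IM] x(1) J'(1) by blast
        ultimately have "insert x I \<in> indeps ?E" by (simp add: indeps_erection)
        then show ?thesis using x X(2) by blast
      qed
    qed
  qed
qed

lemma ground_in_flats: "ground M \<in> flats M"
  by (simp add: flats_def)

text \<open>
  A flat of the erection that contains an independent triple \<open>T\<close> and is not the whole ground set must
  be the member of \<open>P\<close> through \<open>T\<close>; one without such a triple is not affected by the new
  independent sets.
\<close>

lemma flats_erection:
  assumes M: "matroid M" "matroid_rank M = 3" and P: "erection_family M P"
  shows "flats (erection M P) = flats M \<union> P"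
proof (intro subset_antisym subsetI)
  let ?E = "erection M P"
  have E: "matroid ?E" by (rule matroid_erection[OF assms])
  have triple: "\<exists>T\<in>indeps M. T \<subseteq> I \<and> card T = 3" if I: "I \<in> indeps ?E" "3 \<le> card I" for I
  proof -
    obtain T where T: "T \<subseteq> I" "card T = 3" using obtain_subset_with_card_n[OF I(2)] by metis
    then have "T \<in> indeps ?E" using indep_mono[OF E I(1)] by blast
    then show ?thesis using indeps_erection_card_le_3[of T M P] T by auto
  qed
  fix F
  {
    assume F: "F \<in> flats ?E"
    then have FS: "F \<subseteq> ground M" and
      ins: "\<And>x I. x \<in> ground M - F \<Longrightarrow> I \<in> indeps ?E \<Longrightarrow> I \<subseteq> F \<Longrightarrow> insert x I \<in> indeps ?E"
      using flats_iff[OF E] by auto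
    show "F \<in> flats M \<union> P"
    proof (cases "\<exists>T\<in>indeps M. T \<subseteq> F \<and> card T = 3")
      case False
      have "insert x I \<in> indeps M" if x: "x \<in> ground M - F" and I: "I \<in> indeps M" "I \<subseteq> F" for x I
      proof -
        have IE: "I \<in> indeps ?E" using I by (simp add: indeps_erection)
        then have "\<not> 3 \<le> card I" using triple[OF IE] False I(2) by blast
        then have "card (insert x I) \<le> 3" using indep_finite[OF M(1) I(1)] by (simp add: card_insert_if)
        then show ?thesis using ins[OF x IE I(2)] indeps_erection_card_le_3 by blast
      qed
      then show ?thesis using flats_iff[OF M(1)] FS by auto
    next
      case True
      then obtain T where T: "T \<in> indeps M" "T \<subseteq> F" "card T = 3" by blast
      have TE: "T \<in> indeps ?E" using T by (simp add: indeps_erection)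
      have finT: "finite T" by (rule indep_finite[OF M(1) T(1)])
      obtain X where X: "X \<in> P" "T \<subseteq> X" using indep_triple_in_member[OF M P T(1,3)] .
      have new: "card (insert x T) = 4" if "x \<notin> T" for x using that T(3) finT by simp
      show ?thesis
      proof (cases "F = ground M")
        case True
        then show ?thesis using ground_in_flats by blast
      next
        case False
        then obtain y where y: "y \<in> ground M - F" using FS by blast
        have "X \<subseteq> F"
        proof
          fix x assume x: "x \<in> X"
          show "x \<in> F"
          proof (rule ccontr)
            assume "x \<notin> F"
            moreover have "x \<in> ground M" using erection_familyD(1)[OF P X(1)] x by blast
            ultimately have "insert x T \<in> indeps ?E" using ins TE T(2) by blast
            moreover have "insert x T \<subseteq> X" using x X(2) by blast
            ultimately have "insert x T \<in> indeps M" using X(1) by (auto simp: indeps_erection)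
            then have "card (insert x T) \<le> 3" by (rule indep_card_le_3[OF M])
            moreover have "x \<notin> T" using \<open>x \<notin> F\<close> T(2) by blast
            ultimately show False using new by simp
          qed
        qed
        moreover have "F \<subseteq> X"
        proof
          fix x assume x: "x \<in> F"
          show "x \<in> X"
          proof (rule ccontr)
            assume xX: "x \<notin> X"
            then have xT: "x \<notin> T" using X(2) by blast
            have "\<not> insert x T \<subseteq> Y" if "Y \<in> P" for Y
            proof
              assume Y: "insert x T \<subseteq> Y"
              then have "X = Y" using erection_familyD(4)[OF P X(1) that T(1,3) X(2)] by simp
              then show False using Y xX by blast
            qed
            then have "insert x T \<in> indeps ?E"
              using new[OF xT] x T(2) FS by (auto simp: indeps_erection)
            then have "insert y (insert x T) \<in> indeps ?E" using ins[OF y] x T(2) by blast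
            then have "card (insert y (insert x T)) \<le> 4" by (rule erection_card_le[OF M])
            moreover have "card (insert y (insert x T)) = 5"
              using new[OF xT] y x T(2) finT by (subst card_insert_disjoint) auto
            ultimately show False by simp
          qed
        qed
        ultimately have "F = X" by (rule subset_antisym[rotated])
        then show ?thesis using X(1) by simp
      qed
    qed
  }
  {
    assume "F \<in> flats M \<union> P"
    then consider "F = ground M" | "F \<in> flats M" "F \<noteq> ground M" | "F \<in> P" by blast
    then show "F \<in> flats ?E"
    proof cases
      case 1
      then show ?thesis using ground_in_flats[of ?E] by simp
    next
      case 2
      have FS: "F \<subseteq> ground M" using 2(1) by (simp add: flats_def)
      have ins: "\<And>x I. x \<in> ground M - F \<Longrightarrow> I \<in> indeps M \<Longrightarrow> I \<subseteq> F \<Longrightarrow> insert x I \<in> indeps M"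
        using 2(1) flats_iff[OF M(1)] by blast
      have "insert x I \<in> indeps ?E" if x: "x \<in> ground M - F" and I: "I \<in> indeps ?E" "I \<subseteq> F" for x I
      proof (cases "3 \<le> card I")
        case True
        then obtain T where T: "T \<in> indeps M" "T \<subseteq> I" "card T = 3" using triple[OF I(1)] by blast
        have "insert x T \<in> indeps M" using ins[OF x T(1)] T(2) I(2) by blast
        then have "card (insert x T) \<le> 3" by (rule indep_card_le_3[OF M])
        moreover have "card (insert x T) = 4"
          using x T I(2) indep_finite[OF M(1) T(1)] by (subst card_insert_disjoint) auto
        ultimately show ?thesis by simp
      next
        case False
        then have "I \<in> indeps M" using I(1) indeps_erection_card_le_3[of I M P] by simp
        then show ?thesis using ins[OF x _ I(2)] by (simp add: indeps_erection)
      qed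
      then show ?thesis using flats_iff[OF E] FS by auto
    next
      case 3
      obtain T where T: "T \<in> indeps M" "T \<subseteq> F" "card T = 3" and FS: "F \<subseteq> ground M"
        using erection_familyD(1,2)[OF P 3] by blast
      have "insert x I \<in> indeps ?E" if x: "x \<in> ground M - F" and I: "I \<in> indeps ?E" "I \<subseteq> F" for x I
      proof -
        have IM: "I \<in> indeps M" using I 3 by (auto simp: indeps_erection)
        obtain K where K: "K \<in> indeps M" "I \<subseteq> K" "K \<subseteq> I \<union> T" "card K = 3"
          using indep_extend[OF M(1) IM T(1), of 3] indep_card_le_3[OF M IM] T(3) by auto
        have KF: "K \<subseteq> F" using K(3) I(2) T(2) by blast
        have "\<not> insert x K \<subseteq> Y" if "Y \<in> P" for Y
        proof
          assume Y: "insert x K \<subseteq> Y"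
          then have "F = Y" using erection_familyD(4)[OF P 3 that K(1,4) KF] by simp
          then show False using Y x by blast
        qed
        moreover have "card (insert x K) = 4"
          using x K KF indep_finite[OF M(1) K(1)] by (subst card_insert_disjoint) auto
        ultimately have "insert x K \<in> indeps ?E"
          using x KF FS by (auto simp: indeps_erection)
        then show ?thesis using indep_mono[OF E] K(2) by (meson insert_mono)
      qed
      then show ?thesis using flats_iff[OF E] FS by auto
    qed
  }
qed


section \<open>The free erection\<close>

lemma refine_members_invariant:
  assumes "refine_outcome T T' R"
    and base: "\<And>A. A \<in> T \<Longrightarrow> Q A"
    and union: "\<And>A B. Q A \<Longrightarrow> Q B \<Longrightarrow> \<forall>C\<in>T'. \<not> A \<inter> B \<subseteq> C \<Longrightarrow> Q (A \<union> B)"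
    and X: "X \<in> R"
  shows "Q X"
proof -
  have "(refine_step T')\<^sup>*\<^sup>* T R" using assms(1) by (simp add: refine_outcome_def)
  then have "\<forall>X\<in>R. Q X"
  proof induction
    case (step U V)
    from step.hyps(2) obtain A B where "A \<in> U" "B \<in> U" "\<forall>C\<in>T'. \<not> A \<inter> B \<subseteq> C"
      "V = insert (A \<union> B) (U - {A, B})"
      unfolding refine_step_def by blast
    then show ?case using step.IH union by auto
  qed (use base in blast)
  then show ?thesis using X by blast
qed

lemma refine_covers:
  assumes "refine_outcome T T' R" and A: "A \<in> T"
  obtains X where "X \<in> R" "A \<subseteq> X"
proof -
  have "(refine_step T')\<^sup>*\<^sup>* T R" using assms(1) by (simp add: refine_outcome_def)
  then have "\<exists>X\<in>R. A \<subseteq> X"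
  proof induction
    case (step U V)
    from step.hyps(2) obtain C D where "V = insert (C \<union> D) (U - {C, D})"
      unfolding refine_step_def by blast
    then show ?case using step.IH by (metis Diff_iff insert_iff empty_iff le_supI1 le_supI2)
  qed (use A in blast)
  then show thesis using that by blast
qed

lemma erection_planes_outcome:
  assumes "matroid M"
  shows "refine_outcome (expand (ground M) (flats_of_rank 2 M)) (flats_of_rank 2 M) (erection_planes M)"
proof -
  have "expand (ground M) (flats_of_rank 2 M) \<subseteq> Pow (ground M)"
    using flats_of_rankD(3) by (fastforce simp: expand_def)
  then have "finite (expand (ground M) (flats_of_rank 2 M))"
    using matroid_finite_ground[OF assms] finite_subset by blast
  then show ?thesis
    unfolding erection_planes_def refine_def by (rule someI_ex[OF refine_outcome_exists])
qed

text \<open>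
  Uniqueness of the member through a noncollinear triple is the termination condition of the
  refinement: two distinct members meeting in a noncollinear set could still be merged. The other
  conditions hold for the expansion and survive merging.
\<close>

lemma erection_family_erection_planes:
  assumes M: "matroid M" "matroid_rank M = 3"
  shows "erection_family M (erection_planes M)"
proof -
  let ?L = "flats_of_rank 2 M" and ?P = "erection_planes M"
  have out: "refine_outcome (expand (ground M) ?L) ?L ?P" by (rule erection_planes_outcome[OF M(1)])
  have sub: "X \<subseteq> ground M" if "X \<in> ?P" for X
    by (rule refine_members_invariant[OF out _ _ that])
      (auto simp: expand_def dest: flats_of_rankD(3))
  have noncol: "\<exists>T\<in>indeps M. T \<subseteq> X \<and> card T = 3" if "X \<in> ?P" for X
  proof (rule refine_members_invariant[OF out _ _ that])
    fix A assume "A \<in> expand (ground M) ?L"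
    then obtain l a where la: "A = insert a l" "l \<in> ?L" "a \<in> ground M" "a \<notin> l"
      by (auto simp: expand_def)
    obtain I where I: "I \<in> indeps M" "I \<subseteq> l" "card I = 2" using flat_of_rank_basis[OF M(1) la(2)] .
    have "insert a I \<in> indeps M"
      using flats_of_rankD(1)[OF la(2)] flats_iff[OF M(1)] la I by blast
    moreover have "card (insert a I) = 3"
      using I la(4) indep_finite[OF M(1) I(1)] by (subst card_insert_disjoint) auto
    ultimately show "\<exists>T\<in>indeps M. T \<subseteq> A \<and> card T = 3"
      using la(1) I(2) by (intro bexI[of _ "insert a I"]) auto
  qed blast
  have cover: "\<exists>X\<in>?P. insert a l \<subseteq> X" if "l \<in> ?L" "a \<in> ground M - l" for l a
  proof -
    have "insert a l \<in> expand (ground M) ?L" using that by (auto simp: expand_def)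
    then show ?thesis by (metis refine_covers[OF out])
  qed
  have uniq: "X = Y"
    if X: "X \<in> ?P" and Y: "Y \<in> ?P" and T: "T \<in> indeps M" "T \<subseteq> X \<inter> Y" "card T = 3" for X Y T
  proof (rule ccontr)
    assume "X \<noteq> Y"
    moreover have "\<forall>l\<in>?L. \<not> X \<inter> Y \<subseteq> l"
      using noncollinear_iff[OF M, of "X \<inter> Y"] sub[OF X] T by blast
    ultimately have "refine_step ?L ?P (insert (X \<union> Y) (?P - {X, Y}))"
      using X Y unfolding refine_step_def by blast
    then show False using out unfolding refine_outcome_def by blast
  qed
  show ?thesis
    unfolding erection_family_def
  proof (intro conjI ballI impI)
    show "X = Y" if "X \<in> ?P" "Y \<in> ?P" "T \<in> indeps M" "T \<subseteq> X \<inter> Y \<and> card T = 3" for X Y T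
      using uniq[OF that(1-3)] that(4) by simp
  qed (use sub noncol cover in \<open>simp_all\<close>)
qed

lemma free_erection_eq_erection:
  assumes M: "matroid M" "matroid_rank M = 3"
  shows "free_erection M = erection M (erection_planes M)"
proof -
  let ?E = "erection M (erection_planes M)"
  have P: "erection_family M (erection_planes M)" by (rule erection_family_erection_planes[OF M])
  show ?thesis
    unfolding free_erection_def
  proof (rule the_equality)
    show E: "matroid ?E \<and> ground ?E = ground M \<and> flats ?E = flats M \<union> erection_planes M"
      using matroid_erection[OF M P] flats_erection[OF M P] by simp
    fix N assume "matroid N \<and> ground N = ground M \<and> flats N = flats M \<union> erection_planes M"
    then show "N = ?E" using E by (intro matroid_eqI_flats) simp_all
  qed
qed

lemma simple_matroid_free_erection:
  assumes M: "simple_matroid M" "matroid_rank M = 3"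
  shows "simple_matroid (free_erection M)"
proof -
  have m: "matroid M" using M by (simp add: simple_matroid_def)
  then show ?thesis
    using M matroid_erection[OF m M(2) erection_family_erection_planes[OF m M(2)]]
    by (auto simp: simple_matroid_def free_erection_eq_erection indeps_erection)
qed

lemma matroid_rank_free_erection:
  assumes M: "matroid M" "matroid_rank M = 3" and ne: "free_erection M \<noteq> M"
  shows "matroid_rank (free_erection M) = 4"
proof -
  let ?E = "erection M (erection_planes M)"
  have E: "matroid ?E" by (rule matroid_erection[OF M erection_family_erection_planes[OF M]])
  have "indeps ?E \<noteq> indeps M"
    using ne free_erection_eq_erection[OF M] by (auto intro!: set_system.equality)
  moreover have "indeps M \<subseteq> indeps ?E" by (auto simp: indeps_erection)
  ultimately obtain I where I: "I \<in> indeps ?E" "I \<notin> indeps M" by blast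
  then have "card I = 4" by (simp add: indeps_erection)
  then have "4 \<le> matroid_rank ?E"
    using card_le_rank_of[OF E I(1) indep_subset_ground[OF E I(1)]] by (simp add: matroid_rank_def)
  moreover have "matroid_rank ?E \<le> 4"
    using rank_of_basis[OF E, of "ground ?E"] erection_card_le[OF M] unfolding matroid_rank_def by metis
  ultimately show ?thesis using free_erection_eq_erection[OF M] by simp
qed


section \<open>Truncation\<close>

definition truncation :: "nat \<Rightarrow> 'a set_system \<Rightarrow> 'a set_system" where
  "truncation k N = \<lparr>ground = ground N, indeps = {I \<in> indeps N. card I \<le> k}\<rparr>"

lemma truncation_simps [simp]:
  "ground (truncation k N) = ground N"
  "I \<in> indeps (truncation k N) \<longleftrightarrow> I \<in> indeps N \<and> card I \<le> k"
  by (simp_all add: truncation_def)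

lemma matroid_truncation:
  assumes N: "matroid N"
  shows "matroid (truncation k N)"
  unfolding matroid_def
proof (intro conjI ballI allI impI)
  show "finite (ground (truncation k N))" using matroid_finite_ground[OF N] by simp
  show "indeps (truncation k N) \<subseteq> Pow (ground (truncation k N))"
  proof
    fix I assume "I \<in> indeps (truncation k N)"
    then show "I \<in> Pow (ground (truncation k N))" using indep_subset_ground[OF N, of I] by simp
  qed
  show "{} \<in> indeps (truncation k N)" using indep_empty[OF N] by simp
  show "I \<in> indeps (truncation k N)" if "J \<in> indeps (truncation k N)" "I \<subseteq> J" for I J
    using that indep_mono[OF N] card_mono[OF indep_finite[OF N], of J I] by fastforce
  show "\<exists>x\<in>J - I. insert x I \<in> indeps (truncation k N)"
    if I: "I \<in> indeps (truncation k N)" and J: "J \<in> indeps (truncation k N)"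
      and less: "card I < card J" for I J
  proof -
    obtain x where "x \<in> J" "x \<notin> I" "insert x I \<in> indeps N"
      using indep_augment[OF N _ _ less] I J by auto
    moreover from this have "card (insert x I) \<le> k"
      using less I J indep_finite[OF N] by simp
    ultimately show ?thesis by auto
  qed
qed

lemma matroid_rank_truncation:
  assumes N: "matroid N" and k: "k \<le> matroid_rank N"
  shows "matroid_rank (truncation k N) = k"
proof (rule antisym)
  have T: "matroid (truncation k N)" by (rule matroid_truncation[OF N])
  show "matroid_rank (truncation k N) \<le> k"
    unfolding matroid_rank_def using rank_of_basis[OF T] by (metis truncation_simps(2))
  obtain I where "I \<in> indeps N" "I \<subseteq> ground N" "card I = k"
    using indep_in_rank[OF N] k unfolding matroid_rank_def by metis
  then show "k \<le> matroid_rank (truncation k N)"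
    unfolding matroid_rank_def using card_le_rank_of[OF T, of I "ground N"] by simp
qed

lemma simple_matroid_truncation:
  "simple_matroid N \<Longrightarrow> 2 \<le> k \<Longrightarrow> simple_matroid (truncation k N)"
  by (auto simp: simple_matroid_def matroid_truncation)

text \<open>
  Each set arising in the refinement lies in a plane of \<open>N\<close>. Two of them are merged
  only if their intersection contains a noncollinear triple, and then the two surrounding planes of
  \<open>N\<close> coincide.
\<close>

lemma erection_plane_truncation_rank:
  assumes N: "matroid N" and rank: "3 \<le> matroid_rank N"
    and X: "X \<in> erection_planes (truncation 3 N)"
  shows "rank_of N X \<le> 3"
proof -
  let ?M = "truncation 3 N"
  have M: "matroid ?M" "matroid_rank ?M = 3"
    using matroid_truncation[OF N] matroid_rank_truncation[OF N rank] by simp_all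
  have "X \<subseteq> ground N \<and> (\<exists>Y\<in>flats_of_rank 3 N. X \<subseteq> Y)"
  proof (rule refine_members_invariant[OF erection_planes_outcome[OF M(1)] _ _ X])
    fix A assume "A \<in> expand (ground ?M) (flats_of_rank 2 ?M)"
    then obtain l a where la: "A = insert a l" "l \<in> flats_of_rank 2 ?M" "a \<in> ground N"
      by (auto simp: expand_def)
    have AS: "A \<subseteq> ground N" using la flats_of_rankD(3)[OF la(2)] by simp
    have "rank_of N l = 2"
      using rank_of_cong[OF M(1) N, of 3 l] flats_of_rankD(2)[OF la(2)] by simp
    have "rank_of N A \<le> 3"
    proof -
      obtain B where B: "B \<in> indeps N" "B \<subseteq> A" "card B = rank_of N A" using rank_of_basis[OF N] .
      have "B - {a} \<in> indeps N" "B - {a} \<subseteq> l" using indep_mono[OF N B(1)] B(2) la(1) by blast+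
      then have "card (B - {a}) \<le> 2" using card_le_rank_of[OF N] \<open>rank_of N l = 2\<close> by metis
      then show ?thesis
        using B(3) indep_finite[OF N B(1)] by (cases "a \<in> B") auto
    qed
    then show "A \<subseteq> ground N \<and> (\<exists>Y\<in>flats_of_rank 3 N. A \<subseteq> Y)"
      using AS by (metis exists_flat_of_rank_above[OF N AS _ rank])
  next
    fix A B
    assume A: "A \<subseteq> ground N \<and> (\<exists>Y\<in>flats_of_rank 3 N. A \<subseteq> Y)"
      and B: "B \<subseteq> ground N \<and> (\<exists>Y\<in>flats_of_rank 3 N. B \<subseteq> Y)"
      and AB: "\<forall>C\<in>flats_of_rank 2 ?M. \<not> A \<inter> B \<subseteq> C"
    obtain T where T: "T \<in> indeps N" "T \<subseteq> A \<inter> B" "card T = 3"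
    proof -
      have "A \<inter> B \<subseteq> ground ?M" using A by auto
      then show thesis using noncollinear_iff[OF M, of "A \<inter> B"] AB that by auto
    qed
    obtain Y Z where Y: "Y \<in> flats_of_rank 3 N" "A \<subseteq> Y" and Z: "Z \<in> flats_of_rank 3 N" "B \<subseteq> Z"
      using A B by blast
    have "Y = Z" by (rule flats_of_rank_eqI[OF N Y(1) Z(1) T(1,3)]) (use T Y Z in blast)+
    then have "A \<union> B \<subseteq> Y" using Y(2) Z(2) by simp
    then show "A \<union> B \<subseteq> ground N \<and> (\<exists>Y\<in>flats_of_rank 3 N. A \<union> B \<subseteq> Y)"
      using A B Y(1) by auto
  qed
  then show ?thesis using rank_of_mono[OF N] flats_of_rankD(2) by metis
qed

lemma indeps_subset_free_erection_truncation:
  assumes N: "matroid N" and rank: "matroid_rank N = 4"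
  shows "indeps N \<subseteq> indeps (free_erection (truncation 3 N))"
proof
  let ?M = "truncation 3 N"
  have M: "matroid ?M" "matroid_rank ?M = 3"
    using matroid_truncation[OF N] matroid_rank_truncation[OF N, of 3] rank by simp_all
  fix I assume I: "I \<in> indeps N"
  have IS: "I \<subseteq> ground N" by (rule indep_subset_ground[OF N I])
  have "card I \<le> 4" using card_le_rank_of[OF N I IS] rank by (simp add: matroid_rank_def)
  moreover have "\<not> I \<subseteq> X" if X: "X \<in> erection_planes ?M" "card I = 4" for X
    using card_le_rank_of[OF N I, of X] erection_plane_truncation_rank[OF N _ X(1)] rank X(2) by auto
  ultimately show "I \<in> indeps (free_erection ?M)"
    using I IS by (auto simp: free_erection_eq_erection[OF M] indeps_erection)
qed


section \<open>Reduction to free erections\<close>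

theorem theorem4p4:
  shows "(\<forall>N :: 'a set_system.
            simple_matroid N \<and> matroid_rank N = 4 \<longrightarrow> points_lines_planes N)
         \<longleftrightarrow>
         (\<forall>N :: 'a set_system.
            (\<exists>M. simple_matroid M \<and> matroid_rank M = 3 \<and>
                 N = free_erection M \<and> free_erection M \<noteq> M) \<longrightarrow> points_lines_planes N)"
proof (intro iffI allI impI)
  fix N :: "'a set_system"
  assume all: "\<forall>N :: 'a set_system. simple_matroid N \<and> matroid_rank N = 4 \<longrightarrow> points_lines_planes N"
  assume "\<exists>M. simple_matroid M \<and> matroid_rank M = 3 \<and> N = free_erection M \<and> free_erection M \<noteq> M"
  then obtain M where M: "simple_matroid M" "matroid_rank M = 3" "N = free_erection M"
    "free_erection M \<noteq> M" by blast
  have "matroid M" using M(1) by (simp add: simple_matroid_def)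
  then show "points_lines_planes N"
    using all simple_matroid_free_erection[OF M(1,2)] matroid_rank_free_erection[OF _ M(2,4)] M(3) by simp
next
  fix N :: "'a set_system"
  assume free: "\<forall>N :: 'a set_system. (\<exists>M. simple_matroid M \<and> matroid_rank M = 3 \<and>
      N = free_erection M \<and> free_erection M \<noteq> M) \<longrightarrow> points_lines_planes N"
  assume N: "simple_matroid N \<and> matroid_rank N = 4"
  then have mN: "matroid N" by (simp add: simple_matroid_def)
  define M where "M = truncation 3 N"
  have M: "simple_matroid M" "matroid_rank M = 3"
    using N simple_matroid_truncation[of N 3] matroid_rank_truncation[OF mN, of 3]
    by (simp_all add: M_def)
  have mM: "matroid M" using M(1) by (simp add: simple_matroid_def)
  have E: "free_erection M = erection M (erection_planes M)"
    by (rule free_erection_eq_erection[OF mM M(2)])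
  have sub: "indeps N \<subseteq> indeps (free_erection M)"
    using indeps_subset_free_erection_truncation[OF mN] N by (simp add: M_def)
  obtain I where "I \<in> indeps N" "card I = 4"
    using rank_of_basis[OF mN, of "ground N"] N unfolding matroid_rank_def by metis
  then have "I \<in> indeps (free_erection M)" "I \<notin> indeps M" using sub by (auto simp: M_def)
  then have "free_erection M \<noteq> M" by metis
  then have "points_lines_planes (free_erection M)" using free M by blast
  then show "points_lines_planes N"
  proof (rule points_lines_planes_specialize[rotated -1])
    show "simple_matroid (free_erection M)" by (rule simple_matroid_free_erection[OF M])
    show "I \<in> indeps (free_erection M) \<longleftrightarrow> I \<in> indeps N" if "card I \<le> 3" for I
      using indeps_erection_card_le_3[OF that, of M] that by (simp add: E) (simp add: M_def)
  qed (use N sub E in \<open>simp_all add: M_def\<close>)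
qed

end
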